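(* Let $\Omega\subset\mathbb R^n$ be a bounded domain, $1\le m\le n$, $T>0$, $Q_T=\Omega\times(0,T)$ and $\partial'Q_T=(\Omega\times\{0\})\cup(\partial\Omega\times[0,T])$. Let $v,w\in C(\bar Q_T)$ with $v\in C^{2,1}(Q_T)$ and $w\in\mathbf K^{ev}_m(Q_T)$. Assume $E_m[v]-E_m[w]\le0$ in $Q_T$ and $w-v\le0$ on $\partial'Q_T$. Then $w\le v$ in $\bar Q_T$.
   Context: For $S\in\mathrm{Sym}(n)$ and $0\le p\le n$, $T_p(S)$ is the sum of all principal $p\times p$ minors of $S$, with $T_0(S)=1$. For $u(x,t)$, $u_{xx}$ is its Hessian in $x$ and $E_p[u]=-u_t\,T_{p-1}(u_{xx})+T_p(u_{xx})$. For $s\in\mathbb R$, $S\in\mathrm{Sym}(n)$ put $E_p(s,S)=sT_{p-1}(S)+T_p(S)$ and $K^{ev}_m=\{(s,S):E_p(s,S)>0,\ p=1,\dots,m\}$. For a set $D\subset\mathbb R^n\times\mathbb R$, $\mathbf K^{ev}_m(D)$ denotes the set of $u\in C^{2,1}(D)$ such that $(-u_t,u_{xx})\in K^{ev}_m$ at every point of $D$. *)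

theory Defs
  imports "HOL-Analysis.Analysis"
begin

definition principal_minor :: "real^'n^'n::finite \<Rightarrow> 'n set \<Rightarrow> real" where
  "principal_minor S I =
     (\<Sum>p\<in>{p. p permutes I}. of_int (sign p) * (\<Prod>i\<in>I. S $ i $ p i))"

text \<open>T_p(S): sum of all principal p x p minors; T_0(S) = 1.\<close>
definition Tsum :: "nat \<Rightarrow> real^'n^'n::finite \<Rightarrow> real" where
  "Tsum p S = (\<Sum>I\<in>{I. card I = p}. principal_minor S I)"

definition Ep :: "nat \<Rightarrow> real \<Rightarrow> real^'n^'n::finite \<Rightarrow> real" where
  "Ep p s S = s * Tsum (p - 1) S + Tsum p S"

definition Kev :: "nat \<Rightarrow> real \<Rightarrow> real^'n^'n::finite \<Rightarrow> bool" where
  "Kev m s S \<longleftrightarrow> (\<forall>p\<in>{1..m}. Ep p s S > 0)"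

definition pdx :: "'n::finite \<Rightarrow> ((real^'n::finite) \<times> real \<Rightarrow> real) \<Rightarrow> (real^'n) \<times> real \<Rightarrow> real" where
  "pdx i u = (\<lambda>z. deriv (\<lambda>h. u (fst z + h *\<^sub>R axis i 1, snd z)) 0)"

definition pdt :: "((real^'n::finite) \<times> real \<Rightarrow> real) \<Rightarrow> (real^'n) \<times> real \<Rightarrow> real" where
  "pdt u = (\<lambda>z. deriv (\<lambda>s. u (fst z, s)) (snd z))"

definition hess :: "((real^'n::finite) \<times> real \<Rightarrow> real) \<Rightarrow> (real^'n) \<times> real \<Rightarrow> real^'n^'n" where
  "hess u z = (\<chi> i j. pdx i (pdx j u) z)"

definition diff_x :: "'n::finite \<Rightarrow> ((real^'n::finite) \<times> real \<Rightarrow> real) \<Rightarrow> (real^'n) \<times> real \<Rightarrow> bool" where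
  "diff_x i u z \<longleftrightarrow> (\<lambda>h. u (fst z + h *\<^sub>R axis i 1, snd z)) differentiable (at 0)"

definition diff_t :: "((real^'n::finite) \<times> real \<Rightarrow> real) \<Rightarrow> (real^'n) \<times> real \<Rightarrow> bool" where
  "diff_t u z \<longleftrightarrow> (\<lambda>s. u (fst z, s)) differentiable (at (snd z))"

definition C21 :: "((real^'n::finite) \<times> real) set \<Rightarrow> ((real^'n::finite) \<times> real \<Rightarrow> real) \<Rightarrow> bool" where
  "C21 D u \<longleftrightarrow>
     continuous_on D u \<and>
     (\<forall>z\<in>D. diff_t u z \<and> (\<forall>i. diff_x i u z \<and> (\<forall>j. diff_x i (pdx j u) z))) \<and>
     continuous_on D (pdt u) \<and>
     (\<forall>i. continuous_on D (pdx i u)) \<and>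
     (\<forall>i j. continuous_on D (pdx i (pdx j u)))"

definition Eop :: "nat \<Rightarrow> ((real^'n::finite) \<times> real \<Rightarrow> real) \<Rightarrow> (real^'n) \<times> real \<Rightarrow> real" where
  "Eop p u z = Ep p (- pdt u z) (hess u z)"

definition Kev_set :: "nat \<Rightarrow> ((real^'n::finite) \<times> real) set \<Rightarrow> ((real^'n::finite) \<times> real \<Rightarrow> real) set" where
  "Kev_set m D = {u. C21 D u \<and> (\<forall>z\<in>D. Kev m (- pdt u z) (hess u z))}"

end

theory Submission
  imports Defs
begin

text \<open>
  At an interior maximum of \<open>w - v - \<epsilon> t\<close> over \<open>\<Omega> \<times> [0, t\<^sub>1]\<close> with \<open>t\<^sub>1 < T\<close>, one has
  \<open>- v\<^sub>t = - w\<^sub>t + a\<close> with \<open>a > 0\<close> and \<open>v\<^sub>x\<^sub>x = w\<^sub>x\<^sub>x + P\<close> with \<open>P\<close> positive semidefinite, so everything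
  rests on the strict monotonicity \<open>E\<^sub>m(s + a, S + P) > E\<^sub>m(s, S)\<close> on the cone. After diagonalizing
  \<open>S\<close>, \<open>E\<^sub>p(s, S)\<close> is the \<open>p\<close>-th elementary symmetric function of \<open>s\<close> and the eigenvalues of \<open>S\<close>,
  and adding a rank-one matrix \<open>v v\<^sup>T\<close> to \<open>S\<close> adds the sum of \<open>v\<^sub>i\<^sup>2\<close> times the symmetric function of
  order \<open>p - 1\<close> with the \<open>i\<close>-th eigenvalue left out. These are positive because leaving out one
  variable maps the \<open>m\<close>-th Garding cone into the \<open>(m-1)\<close>-st.
\<close>

subsection \<open>Elementary symmetric functions\<close>

text \<open>Taking the index set as an argument turns leaving out a variable into a set difference,
  the operation on which the cone arguments rest.\<close>

definition esym :: "'a set \<Rightarrow> nat \<Rightarrow> ('a \<Rightarrow> real) \<Rightarrow> real" where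
  "esym A k f = (\<Sum>I | I \<subseteq> A \<and> card I = k. \<Prod>i\<in>I. f i)"

lemma esym_0 [simp]: "finite A \<Longrightarrow> esym A 0 f = 1"
proof -
  assume "finite A"
  then have "{I. I \<subseteq> A \<and> card I = 0} = {{}}"
    by (auto dest: finite_subset)
  then show ?thesis by (simp add: esym_def)
qed

lemma esym_eq_0: "finite A \<Longrightarrow> card A < k \<Longrightarrow> esym A k f = 0"
  unfolding esym_def by (rule sum.neutral) (auto dest: card_mono)

lemma esym_insert:
  assumes "finite A" "i \<notin> A"
  shows "esym (insert i A) (Suc k) f = esym A (Suc k) f + f i * esym A k f"
proof -
  let ?S = "\<lambda>k. {I. I \<subseteq> A \<and> card I = k}"
  have fin: "finite (?S k)" for k using assms by simp
  have eq: "{I. I \<subseteq> insert i A \<and> card I = Suc k} = ?S (Suc k) \<union> insert i ` ?S k"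
  proof (intro equalityI subsetI)
    fix I assume I: "I \<in> {I. I \<subseteq> insert i A \<and> card I = Suc k}"
    show "I \<in> ?S (Suc k) \<union> insert i ` ?S k"
    proof (cases "i \<in> I")
      case True
      then have "I = insert i (I - {i})" by auto
      moreover have "I - {i} \<in> ?S k" using I True by auto
      ultimately show ?thesis by blast
    qed (use I in auto)
  next
    fix I assume "I \<in> ?S (Suc k) \<union> insert i ` ?S k"
    then show "I \<in> {I. I \<subseteq> insert i A \<and> card I = Suc k}"
    proof
      assume "I \<in> insert i ` ?S k"
      then obtain J where J: "I = insert i J" "J \<subseteq> A" "card J = k" by auto
      moreover have "finite J" "i \<notin> J" using J assms by (auto dest: finite_subset)
      ultimately show ?thesis by auto
    qed auto
  qed
  have inj: "inj_on (insert i) (?S k)"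
  proof (rule inj_onI)
    fix I J assume "I \<in> ?S k" "J \<in> ?S k" "insert i I = insert i J"
    moreover from this have "i \<notin> I" "i \<notin> J" using assms by auto
    ultimately show "I = J" by (simp add: insert_ident)
  qed
  have "esym (insert i A) (Suc k) f
      = (\<Sum>I\<in>?S (Suc k). prod f I) + (\<Sum>I\<in>insert i ` ?S k. prod f I)"
    unfolding esym_def eq using assms fin by (subst sum.union_disjoint) auto
  also have "(\<Sum>I\<in>insert i ` ?S k. prod f I) = (\<Sum>I\<in>?S k. f i * prod f I)"
    unfolding sum.reindex[OF inj] o_def
  proof (rule sum.cong)
    fix I assume "I \<in> ?S k"
    then have "finite I" "i \<notin> I" using assms by (auto dest: finite_subset)
    then show "prod f (insert i I) = f i * prod f I" by simp
  qed simp
  finally show ?thesis by (simp add: esym_def sum_distrib_left)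
qed

lemma esym_remove:
  assumes "finite A" "i \<in> A"
  shows "esym A (Suc k) f = esym (A - {i}) (Suc k) f + f i * esym (A - {i}) k f"
  using esym_insert[of "A - {i}" i k f] assms by (simp add: insert_absorb)

text \<open>Double counting: each \<open>k\<close>-element subset of \<open>A\<close> avoids exactly
  \<open>card A - k\<close> elements of \<open>A\<close>.\<close>

lemma sum_esym_remove:
  assumes "finite A"
  shows "(\<Sum>i\<in>A. esym (A - {i}) k f) = real (card A - k) * esym A k f"
proof -
  let ?B = "{I. I \<subseteq> A \<and> card I = k}"
  have "(\<Sum>i\<in>A. esym (A - {i}) k f) = (\<Sum>i\<in>A. \<Sum>I | I \<in> ?B \<and> i \<notin> I. prod f I)"
    unfolding esym_def by (intro sum.cong) auto
  also have "\<dots> = (\<Sum>I\<in>?B. \<Sum>i | i \<in> A \<and> i \<notin> I. prod f I)"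
    using assms by (intro sum.swap_restrict) auto
  also have "\<dots> = (\<Sum>I\<in>?B. real (card A - k) * prod f I)"
  proof (rule sum.cong)
    fix I assume I: "I \<in> ?B"
    have "{i. i \<in> A \<and> i \<notin> I} = A - I" by auto
    moreover have "card (A - I) = card A - k"
      using I assms by (auto simp: card_Diff_subset finite_subset)
    ultimately show "(\<Sum>i | i \<in> A \<and> i \<notin> I. prod f I) = real (card A - k) * prod f I"
      by simp
  qed simp
  finally show ?thesis by (simp add: esym_def sum_distrib_left)
qed

text \<open>Euler's identity for a homogeneous polynomial, as \<open>esym (A - {i}) k f\<close> is
  the derivative in the variable \<open>f i\<close>. It follows by summing
  \<open>esym_remove\<close> over \<open>i\<close>.\<close>

lemma esym_Euler:
  assumes "finite A"
  shows "real (Suc k) * esym A (Suc k) f = (\<Sum>i\<in>A. f i * esym (A - {i}) k f)"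
proof (cases "Suc k \<le> card A")
  case True
  have "real (card A) * esym A (Suc k) f = (\<Sum>i\<in>A. esym A (Suc k) f)" by simp
  also have "\<dots> = (\<Sum>i\<in>A. esym (A - {i}) (Suc k) f + f i * esym (A - {i}) k f)"
    by (intro sum.cong refl esym_remove assms)
  also have "\<dots> = real (card A - Suc k) * esym A (Suc k) f + (\<Sum>i\<in>A. f i * esym (A - {i}) k f)"
    using sum_esym_remove[OF assms] by (simp add: sum.distrib)
  finally show ?thesis using True by (simp add: of_nat_diff algebra_simps)
next
  case False
  then have "esym (A - {i}) k f = 0" if "i \<in> A" for i
    using assms that card_Suc_Diff1[OF assms that] by (intro esym_eq_0) auto
  then show ?thesis using False assms by (simp add: esym_eq_0)
qed

text \<open>A \<open>j\<close>-element subset supplying the factors \<open>f i\<close> extends to a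
  \<open>k\<close>-element one in \<open>(card A - j) choose (k - j)\<close> ways. Induction on
  \<open>A\<close> reduces this to Pascal's rule.\<close>

lemma esym_shift:
  assumes "finite A"
  shows "esym A k (\<lambda>i. f i + t)
    = (\<Sum>j\<le>k. real ((card A - j) choose (k - j)) * t ^ (k - j) * esym A j f)"
  using assms
proof (induction A arbitrary: k rule: finite_induct)
  case empty
  show ?case
  proof (cases k)
    case (Suc k')
    have "esym {} j f = (if j = 0 then 1 else 0)" for j :: nat and f :: "'a \<Rightarrow> real"
      by (auto simp: esym_eq_0)
    then show ?thesis using Suc by (auto intro!: sum.neutral[symmetric] simp: Suc_diff_le)
  qed simp
next
  case (insert i A)
  show ?case
  proof (cases k)
    case (Suc p)
    let ?n = "card A"
    let ?c = "\<lambda>n k j. real ((n - j) choose (k - j)) * t ^ (k - j)"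
    \<comment> \<open>For \<open>j > card A\<close> Pascal's rule may fail because subtraction
      truncates, but then \<open>esym A j f = 0\<close>.\<close>
    have pascal: "?c (Suc ?n) (Suc p) j * esym A j f = ?c ?n (Suc p) j * esym A j f
        + t * (?c ?n p j * esym A j f)" if "j \<le> p" for j
    proof (cases "j \<le> ?n")
      case True
      then show ?thesis using that by (simp add: Suc_diff_le algebra_simps)
    qed (use insert in \<open>simp add: esym_eq_0\<close>)
    have S1: "(\<Sum>j\<le>Suc p. ?c (Suc ?n) (Suc p) j * esym A j f)
      = (\<Sum>j\<le>Suc p. ?c ?n (Suc p) j * esym A j f) + t * (\<Sum>j\<le>p. ?c ?n p j * esym A j f)"
    proof -
      have "(\<Sum>j\<le>p. ?c (Suc ?n) (Suc p) j * esym A j f)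
        = (\<Sum>j\<le>p. ?c ?n (Suc p) j * esym A j f + t * (?c ?n p j * esym A j f))"
        using pascal by (intro sum.cong) auto
      then show ?thesis by (simp add: sum.distrib sum_distrib_left)
    qed
    have S2: "(\<Sum>j\<le>Suc p. ?c (Suc ?n) (Suc p) j * esym (insert i A) j f)
      = (\<Sum>j\<le>Suc p. ?c (Suc ?n) (Suc p) j * esym A j f) + f i * (\<Sum>j\<le>p. ?c ?n p j * esym A j f)"
      using insert.hyps
      by (simp add: sum.atMost_Suc_shift esym_insert distrib_left sum.distrib sum_distrib_left
          mult_ac del: sum.atMost_Suc)
    show ?thesis
      unfolding Suc
      using insert.hyps insert.IH[of p] insert.IH[of "Suc p"] S1 S2
      by (simp add: esym_insert algebra_simps del: sum.atMost_Suc)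
  qed (use insert in simp)
qed

text \<open>All summands of the expansion are nonnegative and the one with \<open>j = 0\<close> is
  positive. A positive shift thus moves boundary points of the cone into its interior.\<close>

lemma esym_shift_pos:
  assumes "finite A" "k \<le> card A" "0 < t" "\<And>j. j \<le> k \<Longrightarrow> 0 \<le> esym A j f"
  shows "0 < esym A k (\<lambda>i. f i + t)"
  unfolding esym_shift[OF assms(1)]
proof (rule sum_pos2[of _ 0])
  show "0 < real ((card A - 0) choose (k - 0)) * t ^ (k - 0) * esym A 0 f"
    using assms by simp
  show "\<And>j. j \<in> {..k} \<Longrightarrow> 0 \<le> real ((card A - j) choose (k - j)) * t ^ (k - j) * esym A j f"
    using assms by simp
qed auto

lemma continuous_on_esym_shift:
  "continuous_on S (\<lambda>t. esym A k (\<lambda>i. f i + t))"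
  unfolding esym_def by (intro continuous_intros)

lemma esym_pos:
  assumes "finite A" "k \<le> card A" "\<And>i. i \<in> A \<Longrightarrow> 0 < f i"
  shows "0 < esym A k f"
  unfolding esym_def
proof (rule sum_pos)
  show "{I. I \<subseteq> A \<and> card I = k} \<noteq> {}"
    using obtain_subset_with_card_n[OF assms(2)] by blast
qed (use assms in \<open>auto intro!: prod_pos\<close>)

text \<open>
  Let \<open>B = A - {i}\<close> and \<open>p = m + 1\<close>. If \<open>e\<^sub>p(B) \<le> 0\<close>, a common shift of all variables, which preserves
  the cone, produces \<open>e\<^sub>p(B) = 0\<close>, hence \<open>e\<^sub>p\<^sub>+\<^sub>1(B) = e\<^sub>p\<^sub>+\<^sub>1(A) > 0\<close>. But Euler's identity then reads
  \<open>(p + 1) e\<^sub>p\<^sub>+\<^sub>1(B) = - \<Sum>\<^sub>j f\<^sub>j\<^sup>2 e\<^sub>p\<^sub>-\<^sub>1(B - {j})\<close>, and the right-hand side is at most 0 by the induction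
  hypothesis on the closure of the cone.
\<close>
lemma esym_cone_remove:
  assumes "finite A" "i \<in> A" "\<And>p. p \<le> Suc m \<Longrightarrow> 0 < esym A p f" "p \<le> m"
  shows "0 < esym (A - {i}) p f"
  using assms
proof (induction m arbitrary: A f i p)
  case (Suc m)
  define B where "B = A - {i}"
  have B: "finite B" "A = insert i B" "i \<notin> B" using Suc.prems by (auto simp: B_def)
  have cA: "Suc (Suc m) \<le> card A"
    using Suc.prems(1) Suc.prems(3)[of "Suc (Suc m)"] esym_eq_0[of A "Suc (Suc m)" f] by force
  then have cB: "Suc m \<le> card B" using B by simp
  have low: "0 < esym B p f" if "p \<le> m" for p
    unfolding B_def using Suc.prems that by (intro Suc.IH) auto
  have "0 < esym B (Suc m) f"
  proof (rule ccontr)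
    assume "\<not> 0 < esym B (Suc m) f"
    \<comment> \<open>This shift makes all variables on \<open>B\<close> positive, so the
      intermediate value theorem finds a zero of the function of order \<open>m + 1\<close> between
      0 and \<tau>1.\<close>
    define \<tau>1 where "\<tau>1 = 1 + (\<Sum>j\<in>B. \<bar>f j\<bar>)"
    have "0 < esym B (Suc m) (\<lambda>j. f j + \<tau>1)"
    proof (rule esym_pos[OF B(1) cB])
      fix j assume "j \<in> B"
      then have "\<bar>f j\<bar> \<le> (\<Sum>j\<in>B. \<bar>f j\<bar>)"
        by (intro member_le_sum B) auto
      then show "0 < f j + \<tau>1" by (simp add: \<tau>1_def)
    qed
    moreover have "0 \<le> \<tau>1" by (simp add: \<tau>1_def sum_nonneg)
    ultimately obtain \<tau> where \<tau>: "0 \<le> \<tau>" "esym B (Suc m) (\<lambda>j. f j + \<tau>) = 0"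
      using IVT'[of "\<lambda>t. esym B (Suc m) (\<lambda>j. f j + t)" 0 0 \<tau>1]
        continuous_on_esym_shift \<open>\<not> 0 < esym B (Suc m) f\<close> by fastforce
    define g where "g = (\<lambda>j. f j + \<tau>)"
    have zero: "esym B (Suc m) g = 0" using \<tau> by (simp add: g_def)
    have posA: "0 < esym A p g" if "p \<le> Suc (Suc m)" for p
    proof (cases "\<tau> = 0")
      case True
      then show ?thesis using Suc.prems(3)[OF that] by (simp add: g_def)
    next
      case False
      then show ?thesis unfolding g_def
        using Suc.prems cA that \<tau> by (intro esym_shift_pos) (auto intro: less_imp_le)
    qed
    have posB: "0 < esym B p g" if "p \<le> m" for p
      unfolding B_def using Suc.prems posA that by (intro Suc.IH) auto
    \<comment> \<open>Over \<open>B\<close> the family \<open>g\<close> is only on the boundary of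
      the cone, so the induction hypothesis is applied to \<open>g + \<epsilon>\<close> and
      \<epsilon> tends to 0 from the right.\<close>
    have nonneg: "0 \<le> esym (B - {j}) m g" if j: "j \<in> B" for j
    proof (rule tendsto_lowerbound)
      show "((\<lambda>\<epsilon>. esym (B - {j}) m (\<lambda>i. g i + \<epsilon>)) \<longlongrightarrow> esym (B - {j}) m g) (at_right 0)"
      proof -
        have "isCont (\<lambda>\<epsilon>. esym (B - {j}) m (\<lambda>i. g i + \<epsilon>)) 0"
          using continuous_on_esym_shift[of UNIV "B - {j}" m g]
          by (simp add: continuous_on_eq_continuous_at)
        then show ?thesis by (simp add: isCont_def filterlim_at_split)
      qed
      show "\<forall>\<^sub>F \<epsilon> in at_right 0. 0 \<le> esym (B - {j}) m (\<lambda>i. g i + \<epsilon>)"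
        unfolding eventually_at_right_field
      proof (intro exI[of _ 1] conjI allI impI)
        fix \<epsilon> :: real assume \<epsilon>: "0 < \<epsilon>"
        have "0 < esym B p (\<lambda>i. g i + \<epsilon>)" if "p \<le> Suc m" for p
          using posB[THEN less_imp_le] zero that cB \<epsilon>
          by (intro esym_shift_pos B) (auto simp: le_Suc_eq)
        then show "0 \<le> esym (B - {j}) m (\<lambda>i. g i + \<epsilon>)"
          using Suc.IH[OF B(1) j] by (simp add: less_imp_le)
      qed simp
    qed simp
    have "real (Suc (Suc m)) * esym B (Suc (Suc m)) g = (\<Sum>j\<in>B. g j * esym (B - {j}) (Suc m) g)"
      by (rule esym_Euler[OF B(1)])
    \<comment> \<open>The vanishing of \<open>esym B (Suc m) g\<close> turns
      \<open>esym (B - {j}) (Suc m) g\<close> into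
      \<open>- g j * esym (B - {j}) m g\<close>.\<close>
    also have "\<dots> = (\<Sum>j\<in>B. - (g j * g j * esym (B - {j}) m g))"
      using esym_remove[OF B(1), of _ m g] zero by (intro sum.cong) (auto simp: add_eq_0_iff2)
    also have "\<dots> \<le> 0" using nonneg by (intro sum_nonpos) auto
    finally have "esym B (Suc (Suc m)) g \<le> 0" by (simp add: mult_le_0_iff)
    moreover have "esym A (Suc (Suc m)) g = esym B (Suc (Suc m)) g"
      using esym_insert[OF B(1,3), of "Suc m" g] zero B(2) by simp
    ultimately show False using posA[of "Suc (Suc m)"] by simp
  qed
  then show ?case using low Suc.prems(4) by (auto simp: le_Suc_eq B_def)
qed simp

subsection \<open>Principal minors\<close>

definition diagm :: "('n \<Rightarrow> real) \<Rightarrow> real^'n^'n" where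
  "diagm d = (\<chi> i j. if i = j then d i else 0)"

definition outer :: "real^'n \<Rightarrow> real^'n^'n" where
  "outer v = (\<chi> i j. v $ i * v $ j)"

lemma principal_minor_empty [simp]: "principal_minor S {} = 1"
  by (simp add: principal_minor_def sign_id)

lemma principal_minor_singleton [simp]: "principal_minor S {i} = S $ i $ i"
  by (simp add: principal_minor_def sign_id)

lemma principal_minor_UNIV: "principal_minor S UNIV = det S"
  by (simp add: principal_minor_def det_def)

lemma principal_minor_scaleR: "principal_minor (t *\<^sub>R S) I = t ^ card I * principal_minor S I"
  by (simp add: principal_minor_def prod.distrib sum_distrib_left mult_ac)

text \<open>The products are multiplied out, with \<open>J\<close> the set of rows whose factor
  comes from \<open>M\<close>. A nonzero diagonal factor forces the permutation to fix its row, so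
  only permutations of \<open>J\<close> remain.\<close>

lemma principal_minor_diagm_add:
  "principal_minor (diagm d + M) I = (\<Sum>J\<in>Pow I. (\<Prod>i\<in>I - J. d i) * principal_minor M J)"
proof -
  let ?Q = "\<lambda>I. {p. p permutes I}"
  let ?D = "\<lambda>p i. if i = p i then d i else 0"
  have fin: "finite (?Q I)" by (simp add: finite_permutations)
  have "principal_minor (diagm d + M) I
      = (\<Sum>p\<in>?Q I. of_int (sign p) * (\<Prod>i\<in>I. M $ i $ p i + ?D p i))"
    by (simp add: principal_minor_def diagm_def add.commute)
  also have "\<dots> = (\<Sum>p\<in>?Q I. \<Sum>J\<in>Pow I.
      of_int (sign p) * ((\<Prod>i\<in>J. M $ i $ p i) * (\<Prod>i\<in>I - J. ?D p i)))"
    by (simp add: prod_add sum_distrib_left)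
  also have "\<dots> = (\<Sum>J\<in>Pow I. \<Sum>p\<in>?Q I.
      of_int (sign p) * ((\<Prod>i\<in>J. M $ i $ p i) * (\<Prod>i\<in>I - J. ?D p i)))"
    by (rule sum.swap)
  also have "\<dots> = (\<Sum>J\<in>Pow I. (\<Prod>i\<in>I - J. d i) * principal_minor M J)"
  proof (rule sum.cong)
    fix J assume J: "J \<in> Pow I"
    have "(\<Sum>p\<in>?Q I. of_int (sign p) * ((\<Prod>i\<in>J. M $ i $ p i) * (\<Prod>i\<in>I - J. ?D p i)))
        = (\<Sum>p\<in>?Q J. of_int (sign p) * ((\<Prod>i\<in>J. M $ i $ p i) * (\<Prod>i\<in>I - J. ?D p i)))"
    proof (rule sum.mono_neutral_right[OF fin])
      show "?Q J \<subseteq> ?Q I" using J by (auto intro: permutes_subset)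
      show "\<forall>p\<in>?Q I - ?Q J.
        of_int (sign p) * ((\<Prod>i\<in>J. M $ i $ p i) * (\<Prod>i\<in>I - J. ?D p i)) = 0"
      proof
        fix p assume p: "p \<in> ?Q I - ?Q J"
        then obtain i where "i \<in> I - J" "p i \<noteq> i"
          using permutes_superset[of p I J] by auto
        then have "(\<Prod>i\<in>I - J. ?D p i) = 0"
          by (intro prod_zero bexI[of _ i]) auto
        then show "of_int (sign p) * ((\<Prod>i\<in>J. M $ i $ p i) * (\<Prod>i\<in>I - J. ?D p i)) = 0"
          by simp
      qed
    qed
    also have "\<dots> = (\<Sum>p\<in>?Q J. (\<Prod>i\<in>I - J. d i) * (of_int (sign p) * (\<Prod>i\<in>J. M $ i $ p i)))"
    proof (rule sum.cong)
      fix p assume "p \<in> ?Q J"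
      then have "(\<Prod>i\<in>I - J. ?D p i) = (\<Prod>i\<in>I - J. d i)"
        by (intro prod.cong) (auto simp: permutes_not_in)
      then show "of_int (sign p) * ((\<Prod>i\<in>J. M $ i $ p i) * (\<Prod>i\<in>I - J. ?D p i))
          = (\<Prod>i\<in>I - J. d i) * (of_int (sign p) * (\<Prod>i\<in>J. M $ i $ p i))"
        by simp
    qed simp
    finally show "(\<Sum>p\<in>?Q I. of_int (sign p) * ((\<Prod>i\<in>J. M $ i $ p i) * (\<Prod>i\<in>I - J. ?D p i)))
      = (\<Prod>i\<in>I - J. d i) * principal_minor M J"
      by (simp add: principal_minor_def sum_distrib_left)
  qed simp
  finally show ?thesis .
qed

text \<open>All permutations of \<open>J\<close> contribute the same product up to sign, and
  composition with the transposition of \<open>a\<close> and \<open>b\<close> shows that the signs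
  sum to 0.\<close>

lemma principal_minor_outer_eq_0:
  assumes "a \<in> J" "b \<in> J" "a \<noteq> b"
  shows "principal_minor (outer v) J = 0"
proof -
  let ?Q = "{p. p permutes J}"
  let ?t = "Transposition.transpose a b"
  have t: "?t permutes J" using assms by (intro permutes_swap_id) auto
  have sgn: "of_int (sign (p \<circ> ?t)) = - (of_int (sign p) :: real)" if "p \<in> ?Q" for p
    using that t assms(3)
    by (simp add: sign_compose permutes_imp_permutation[of J] sign_swap_id)
  have "(\<Sum>p\<in>?Q. of_int (sign p) :: real) = (\<Sum>p\<in>?Q. - of_int (sign p))"
    by (subst sum_permutations_compose_right[OF t]) (intro sum.cong refl sgn)
  then have 0: "(\<Sum>p\<in>?Q. of_int (sign p) :: real) = 0" by (simp add: sum_negf)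
  have "principal_minor (outer v) J = (\<Sum>p\<in>?Q. of_int (sign p) * ((\<Prod>i\<in>J. v $ i) * (\<Prod>i\<in>J. v $ i)))"
    unfolding principal_minor_def
  proof (rule sum.cong)
    fix p assume "p \<in> ?Q"
    then have "(\<Prod>i\<in>J. v $ p i) = (\<Prod>i\<in>J. v $ i)"
      using prod.permute[of p J "\<lambda>i. v $ i"] by (simp add: o_def)
    then show "of_int (sign p) * (\<Prod>i\<in>J. outer v $ i $ p i)
      = of_int (sign p) * ((\<Prod>i\<in>J. v $ i) * (\<Prod>i\<in>J. v $ i))"
      by (simp add: outer_def prod.distrib)
  qed simp
  then show ?thesis using 0 by (simp flip: sum_distrib_right)
qed

text \<open>In the diagonal expansion only the empty set and the singletons survive, since larger
  minors of a rank-one matrix vanish.\<close>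

lemma principal_minor_diagm_add_outer:
  "principal_minor (diagm d + outer v) I = prod d I + (\<Sum>i\<in>I. (v $ i)\<^sup>2 * prod d (I - {i}))"
proof -
  let ?f = "\<lambda>J. (\<Prod>i\<in>I - J. d i) * principal_minor (outer v) J"
  have "principal_minor (diagm d + outer v) I = (\<Sum>J\<in>Pow I. ?f J)"
    by (rule principal_minor_diagm_add)
  also have "\<dots> = (\<Sum>J\<in>insert {} ((\<lambda>i. {i}) ` I). ?f J)"
  proof (rule sum.mono_neutral_right)
    show "\<forall>J\<in>Pow I - insert {} ((\<lambda>i. {i}) ` I). ?f J = 0"
    proof
      fix J assume J: "J \<in> Pow I - insert {} ((\<lambda>i. {i}) ` I)"
      then obtain a where "a \<in> J" by auto
      moreover have "J \<noteq> {a}" using J \<open>a \<in> J\<close> by auto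
      ultimately obtain b where "b \<in> J" "a \<noteq> b" by auto
      with \<open>a \<in> J\<close> show "?f J = 0" by (simp add: principal_minor_outer_eq_0)
    qed
  qed auto
  also have "\<dots> = ?f {} + (\<Sum>J\<in>(\<lambda>i. {i}) ` I. ?f J)"
    by (subst sum.insert) auto
  also have "(\<Sum>J\<in>(\<lambda>i. {i}) ` I. ?f J) = (\<Sum>i\<in>I. ?f {i})"
    by (subst sum.reindex) (auto simp: inj_on_def)
  finally show ?thesis by (simp add: outer_def power2_eq_square mult.commute)
qed

lemma Tsum_0 [simp]: "Tsum 0 S = 1"
  by (simp add: Tsum_def)

text \<open>After the sums over \<open>I\<close> and \<open>i\<close> are exchanged, removing
  \<open>i\<close> matches the sets \<open>I\<close> containing it with the \<open>k\<close>-subsets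
  of its complement.\<close>

lemma Tsum_diagm_add_outer:
  "Tsum (Suc k) (diagm d + outer v)
    = esym UNIV (Suc k) d + (\<Sum>i\<in>UNIV. (v $ i)\<^sup>2 * esym (UNIV - {i}) k d)"
proof -
  let ?B = "{I. card I = Suc k} :: 'a set set"
  have swap: "(\<Sum>I\<in>?B. \<Sum>i\<in>I. (v $ i)\<^sup>2 * prod d (I - {i}))
      = (\<Sum>i\<in>UNIV. \<Sum>I | I \<in> ?B \<and> i \<in> I. (v $ i)\<^sup>2 * prod d (I - {i}))"
    using sum.swap_restrict[of ?B UNIV "\<lambda>I i. (v $ i)\<^sup>2 * prod d (I - {i})" "\<lambda>I i. i \<in> I"] by simp
  have inner: "(\<Sum>I | I \<in> ?B \<and> i \<in> I. prod d (I - {i})) = esym (UNIV - {i}) k d" for i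
    unfolding esym_def
    by (rule sum.reindex_bij_witness[of _ "insert i" "\<lambda>I. I - {i}"])
       (auto simp: insert_absorb card_insert_if)
  show ?thesis
    unfolding Tsum_def principal_minor_diagm_add_outer sum.distrib swap
    by (simp add: esym_def[of UNIV] flip: inner sum_distrib_left)
qed

section \<open>Diagonal matrices and orthogonal invariance of \<open>Tsum\<close>\<close>

lemma outer_0: "outer 0 = 0"
  by (simp add: outer_def vec_eq_iff)

lemma Tsum_diagm: "Tsum k (diagm d) = esym UNIV k d"
  using Tsum_diagm_add_outer[of _ d 0] by (cases k) (simp_all add: outer_0)

text \<open>Exhibiting \<open>Tsum k S\<close> as a coefficient of a determinant makes its
  invariance under orthogonal conjugation accessible.\<close>

lemma det_one_add_scaleR:
  fixes S :: "real^'n^'n"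
  shows "det (mat 1 + t *\<^sub>R S) = (\<Sum>k\<le>CARD('n). Tsum k S * t ^ k)"
proof -
  have "mat 1 = (diagm (\<lambda>_. 1) :: real^'n^'n)"
    by (simp add: diagm_def mat_def vec_eq_iff)
  then have "det (mat 1 + t *\<^sub>R S) = (\<Sum>J\<in>UNIV. t ^ card J * principal_minor S J)"
    by (simp add: principal_minor_diagm_add principal_minor_scaleR flip: principal_minor_UNIV)
  also have "\<dots> = (\<Sum>k\<le>CARD('n). \<Sum>J | J \<in> UNIV \<and> card J = k. t ^ card J * principal_minor S J)"
    by (rule sum.group[symmetric]) (auto intro: card_mono)
  finally show ?thesis by (simp add: Tsum_def sum_distrib_left mult.commute)
qed

lemma matrix_add_rdistrib: "(A + B) ** C = A ** C + B ** (C :: real^'k^'n)"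
  by (simp add: matrix_matrix_mult_def vec_eq_iff distrib_right sum.distrib)

text \<open>Conjugation preserves \<open>det (mat 1 + t *\<^sub>R S)\<close> for all
  \<open>t\<close>, and polynomials in \<open>t\<close> that agree everywhere have equal
  coefficients.\<close>

lemma Tsum_orthogonal:
  fixes S Q :: "real^'n^'n"
  assumes "orthogonal_matrix Q"
  shows "Tsum k (Q ** S ** transpose Q) = Tsum k S"
proof (cases "k \<le> CARD('n)")
  case True
  have QQ: "Q ** transpose Q = mat 1" using assms by (simp add: orthogonal_matrix_def)
  then have detQ: "det Q * det Q = 1" using det_mul[of Q "transpose Q"] by (simp add: det_transpose)
  have "(\<Sum>k\<le>CARD('n). Tsum k (Q ** S ** transpose Q) * t ^ k) = (\<Sum>k\<le>CARD('n). Tsum k S * t ^ k)" for t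
  proof -
    have "mat 1 + t *\<^sub>R (Q ** S ** transpose Q) = Q ** (mat 1 + t *\<^sub>R S) ** transpose Q"
      by (simp add: matrix_add_ldistrib matrix_add_rdistrib QQ matrix_scalar_ac scalar_matrix_assoc)
    then have "det (mat 1 + t *\<^sub>R (Q ** S ** transpose Q)) = det (mat 1 + t *\<^sub>R S)"
      using detQ by (simp add: det_mul det_transpose mult_ac)
    then show ?thesis by (simp add: det_one_add_scaleR)
  qed
  then show ?thesis using True
    using polyfun_eq_coeffs[of "\<lambda>k. Tsum k (Q ** S ** transpose Q)" "CARD('n)" "\<lambda>k. Tsum k S"] by blast
next
  case False
  then have "{I :: 'n set. card I = k} = {}"
    using card_mono[of "UNIV :: 'n set"] by fastforce
  then show ?thesis by (simp only: Tsum_def sum.empty)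
qed

subsection \<open>Diagonalization of symmetric matrices\<close>

text \<open>A maximizer of the quadratic form on the unit sphere of \<open>V\<close> is an
  eigenvector: otherwise moving along the residual \<open>w\<close> would increase the Rayleigh
  quotient.\<close>

lemma selfadjoint_eigenvector:
  fixes f :: "'a::euclidean_space \<Rightarrow> 'a"
  assumes f: "linear f" and sa: "\<And>x y. f x \<bullet> y = x \<bullet> f y"
    and V: "subspace V" "V \<noteq> {0}" and inv: "f ` V \<subseteq> V"
  obtains v c where "v \<in> V" "norm v = 1" "f v = c *\<^sub>R v"
proof -
  let ?K = "V \<inter> sphere 0 1"
  have lin: "continuous_on S f" for S
    by (rule linear_continuous_on) (use f in \<open>simp add: linear_conv_bounded_linear\<close>)
  obtain x where "x \<in> V" "x \<noteq> 0" using V subspace_0 by fastforce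
  then have "(1 / norm x) *\<^sub>R x \<in> ?K" using V by (auto simp: subspace_scale)
  then have "?K \<noteq> {}" by blast
  moreover have "compact ?K"
    using V by (simp add: closed_Int_compact closed_subspace)
  ultimately obtain v where v: "v \<in> ?K" and max: "\<And>y. y \<in> ?K \<Longrightarrow> y \<bullet> f y \<le> v \<bullet> f v"
    using continuous_attains_sup[of ?K "\<lambda>x. x \<bullet> f x"] by (force intro!: continuous_intros lin)
  define c where "c = v \<bullet> f v"
  have vv: "v \<bullet> v = 1" using v by (simp add: dot_square_norm)
  have quad: "y \<bullet> f y \<le> c * (y \<bullet> y)" if "y \<in> V" for y
  proof (cases "y = 0")
    case False
    then have "(1 / norm y) *\<^sub>R y \<in> ?K" using V that by (auto simp: subspace_scale)
    from max[OF this] have "(y \<bullet> f y) / (norm y * norm y) \<le> c"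
      by (simp add: c_def linear_scale[OF f])
    then show ?thesis using False by (simp add: dot_square_norm power2_eq_square field_simps)
  qed (simp add: linear_0[OF f])
  define w where "w = f v - c *\<^sub>R v"
  have wV: "w \<in> V" using v inv V by (auto simp: w_def intro!: subspace_diff subspace_scale)
  have "w = 0"
  proof (rule ccontr)
    assume "w \<noteq> 0"
    define K where "K = c * (w \<bullet> w) - w \<bullet> f w"
    have ww: "0 < w \<bullet> w" using \<open>w \<noteq> 0\<close> by simp
    \<comment> \<open>Inserting \<open>v + t *\<^sub>R w\<close> into the quadratic bound leaves a
      first-order gain in \<open>t\<close> against a second-order loss.\<close>
    have ineq: "2 * t * (w \<bullet> w) \<le> t\<^sup>2 * K" for t
    proof -
      have "v + t *\<^sub>R w \<in> V" using v wV V by (auto intro!: subspace_add subspace_scale)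
      from quad[OF this] have
        "c + 2 * t * (w \<bullet> f v) + t\<^sup>2 * (w \<bullet> f w) \<le> c * (1 + 2 * t * (w \<bullet> v) + t\<^sup>2 * (w \<bullet> w))"
        using sa[of v w] vv
        by (simp add: linear_add[OF f] linear_scale[OF f] inner_simps c_def inner_commute
            power2_eq_square algebra_simps)
      moreover have "w \<bullet> f v = w \<bullet> w + c * (w \<bullet> v)"
        by (simp add: w_def inner_simps)
      ultimately show ?thesis
        by (simp add: K_def distrib_left mult_ac right_diff_distrib)
    qed
    \<comment> \<open>Chosen so that \<open>t * (\<bar>K\<bar> + 1) = w \<bullet> w\<close>, which
      makes the gain exceed the loss; the 1 keeps the denominator positive.\<close>
    define t where "t = (w \<bullet> w) / (\<bar>K\<bar> + 1)"
    have "0 < t" using ww by (simp add: t_def)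
    with ineq[of t] have "2 * (w \<bullet> w) \<le> t * K"
      by (simp add: power2_eq_square)
    also have "\<dots> \<le> t * (\<bar>K\<bar> + 1)" using \<open>0 < t\<close> by (intro mult_left_mono) auto
    also have "\<dots> = w \<bullet> w" by (simp add: t_def)
    finally show False using ww by simp
  qed
  then have "f v = c *\<^sub>R v" by (simp add: w_def)
  then show ?thesis using that v by auto
qed

text \<open>Induction on the dimension: a unit eigenvector is split off, and its orthogonal
  complement in \<open>V\<close> is again invariant because \<open>f\<close> is self-adjoint. This
  is why general invariant subspaces appear.\<close>

lemma selfadjoint_eigenbasis:
  fixes f :: "'a::euclidean_space \<Rightarrow> 'a"
  assumes f: "linear f" and sa: "\<And>x y. f x \<bullet> y = x \<bullet> f y"
    and V: "subspace V" and inv: "f ` V \<subseteq> V"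
  shows "\<exists>B. B \<subseteq> V \<and> pairwise orthogonal B \<and> (\<forall>b\<in>B. norm b = 1 \<and> (\<exists>c. f b = c *\<^sub>R b)) \<and> V \<subseteq> span B"
  using V inv
proof (induction "dim V" arbitrary: V rule: less_induct)
  case less
  show ?case
  proof (cases "V = {0}")
    case True
    then show ?thesis by (intro exI[of _ "{}"]) auto
  next
    case False
    obtain v c where v: "v \<in> V" "norm v = 1" "f v = c *\<^sub>R v"
      using selfadjoint_eigenvector[OF f sa less.prems(1) False less.prems(2)] by blast
    define W where "W = V \<inter> {x. v \<bullet> x = 0}"
    have vv: "v \<bullet> v = 1" using v by (simp add: dot_square_norm)
    have W: "subspace W" unfolding W_def
      by (intro subspace_inter less.prems subspace_hyperplane)
    have "f ` W \<subseteq> W"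
    proof
      fix y assume "y \<in> f ` W"
      then obtain x where x: "x \<in> V" "v \<bullet> x = 0" "y = f x" by (auto simp: W_def)
      then have "v \<bullet> y = 0" using sa[of v x] v(3) by simp
      then show "y \<in> W" using x less.prems(2) by (auto simp: W_def)
    qed
    moreover have "dim W < dim V"
    proof -
      have "W \<subseteq> V" by (simp add: W_def)
      moreover have "v \<notin> W" using vv by (simp add: W_def)
      then have "W \<noteq> V" using v by blast
      ultimately show ?thesis
        using subspace_dim_equal[OF W less.prems(1)] by (meson not_le)
    qed
    ultimately obtain B where B: "B \<subseteq> W" "pairwise orthogonal B"
        "\<forall>b\<in>B. norm b = 1 \<and> (\<exists>c. f b = c *\<^sub>R b)" "W \<subseteq> span B"
      using less.hyps[OF _ W] by blast
    show ?thesis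
    proof (intro exI[of _ "insert v B"] conjI)
      show "insert v B \<subseteq> V" using B v by (auto simp: W_def)
      show "pairwise orthogonal (insert v B)"
        using B by (auto simp: pairwise_insert orthogonal_def W_def inner_commute)
      show "\<forall>b\<in>insert v B. norm b = 1 \<and> (\<exists>c. f b = c *\<^sub>R b)" using B v by auto
      show "V \<subseteq> span (insert v B)"
      proof
        fix x assume x: "x \<in> V"
        have "x - (v \<bullet> x) *\<^sub>R v \<in> W"
          using x v vv less.prems(1)
          by (auto simp: W_def inner_simps intro!: subspace_diff subspace_scale)
        then show "x \<in> span (insert v B)"
          using B(4) by (auto simp: span_insert)
      qed
    qed
  qed
qed

theorem symmetric_matrix_diagonalizable:
  fixes S :: "real^'n^'n"
  assumes "transpose S = S"
  obtains Q d where "orthogonal_matrix Q" "Q ** S ** transpose Q = diagm d"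
proof -
  have sa: "(S *v x) \<bullet> y = x \<bullet> (S *v y)" for x y
    by (metis assms dot_lmul_matrix vector_transpose_matrix)
  obtain B where B: "pairwise orthogonal B" "\<forall>b\<in>B. norm b = 1 \<and> (\<exists>c. S *v b = c *\<^sub>R b)" "UNIV \<subseteq> span B"
    using selfadjoint_eigenbasis[OF matrix_vector_mul_linear[of S] sa, of UNIV] by auto
  have "0 \<notin> B" using B(2) by force
  then have ind: "independent B" using B(1) by (rule pairwise_orthogonal_independent[rotated])
  then have "finite B" "card B = CARD('n)"
    using B(3) independent_bound_general[of B] basis_card_eq_dim[of B UNIV] by auto
  then obtain e :: "'n \<Rightarrow> real^'n" where e: "bij_betw e UNIV B"
    using finite_same_card_bij[of "UNIV :: 'n set" B] by auto
  have eB: "e k \<in> B" for k using e by (auto simp: bij_betw_def)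
  have ee: "e k \<bullet> e l = (if k = l then 1 else 0)" for k l
  proof (cases "k = l")
    case True
    then show ?thesis using B(2) eB[of l] by (simp add: dot_square_norm)
  next
    case False
    then have "e k \<noteq> e l" using e by (auto simp: bij_betw_def inj_on_def)
    then show ?thesis using B(1) eB False by (auto simp: pairwise_def orthogonal_def)
  qed
  have "\<forall>k. \<exists>c. S *v e k = c *\<^sub>R e k" using B(2) eB by blast
  from choice[OF this] obtain d where d: "\<forall>k. S *v e k = d k *\<^sub>R e k" ..
  define Q where "Q = (\<chi> k i. e k $ i)"
  have row: "row k Q = e k" for k by (simp add: Q_def row_def vec_eq_iff)
  have "orthogonal_matrix Q"
    unfolding orthogonal_matrix_orthonormal_rows row
    using ee by (simp add: norm_eq_1 orthogonal_def)
  moreover have "Q ** S ** transpose Q = diagm d"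
  proof -
    define R where "R = S ** transpose Q"
    have "R $ i $ l = d l * e l $ i" for i l
      using arg_cong[OF spec[OF d, of l], of "\<lambda>v. v $ i"]
      by (simp add: R_def matrix_matrix_mult_def matrix_vector_mult_def transpose_def Q_def)
    then have "(Q ** R) $ k $ l = d l * (e k \<bullet> e l)" for k l
      by (simp add: matrix_matrix_mult_def Q_def inner_vec_def sum_distrib_left mult_ac)
    then show ?thesis by (simp add: vec_eq_iff diagm_def ee R_def matrix_mul_assoc)
  qed
  ultimately show ?thesis using that by blast
qed

subsection \<open>Monotonicity on the cone\<close>

lemma esym_reindex:
  assumes "inj_on h A"
  shows "esym (h ` A) k f = esym A k (f \<circ> h)"
proof -
  let ?S = "{I. I \<subseteq> A \<and> card I = k}"
  have injI: "inj_on h I" if "I \<subseteq> A" for I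
    using inj_on_subset[OF assms that] .
  have eq: "{I. I \<subseteq> h ` A \<and> card I = k} = (`) h ` ?S"
  proof (intro equalityI subsetI)
    fix I assume I: "I \<in> {I. I \<subseteq> h ` A \<and> card I = k}"
    then obtain J where J: "J \<subseteq> A" "I = h ` J" by (auto elim: subset_imageE)
    then have "card J = k" using I card_image[OF injI] by simp
    with J show "I \<in> (`) h ` ?S" by blast
  next
    fix I assume "I \<in> (`) h ` ?S"
    then obtain J where "J \<subseteq> A" "card J = k" "I = h ` J" by blast
    then show "I \<in> {I. I \<subseteq> h ` A \<and> card I = k}"
      using card_image[OF injI] by auto
  qed
  have inj: "inj_on ((`) h) ?S"
  proof (rule inj_onI)
    fix I J assume "I \<in> ?S" "J \<in> ?S" "h ` I = h ` J"
    then show "I = J" using inj_on_image_eq_iff[OF assms, of I J] by simp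
  qed
  show ?thesis
    unfolding esym_def eq sum.reindex[OF inj] o_def
  proof (rule sum.cong)
    fix I assume "I \<in> ?S"
    then show "prod f (h ` I) = (\<Prod>i\<in>I. f (h i))"
      using prod.reindex[OF injI, of I f] by (simp add: o_def)
  qed simp
qed

text \<open>The variable \<open>s\<close> joins the eigenvalues at the index \<open>None\<close>, so
  that \<open>Ep\<close> becomes an elementary symmetric function of variables indexed by
  \<open>'n option\<close>.\<close>

lemma esym_insert_None:
  fixes d :: "'n::finite \<Rightarrow> real"
  shows "esym (insert None (Some ` A)) (Suc k) (case_option s d) = esym A (Suc k) d + s * esym A k d"
  by (subst esym_insert) (simp_all add: esym_reindex o_def)

text \<open>Stated for successors because \<open>p - 1\<close> truncates: at order 0,
  \<open>Ep\<close> is \<open>s + 1\<close> rather than 1.\<close>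

lemma Ep_diagm: "Ep (Suc k) s (diagm d) = esym UNIV (Suc k) (case_option s d)"
  by (simp add: Ep_def Tsum_diagm UNIV_option_conv esym_insert_None)

text \<open>The increments of \<open>Tsum (Suc k)\<close> and \<open>s * Tsum k\<close> recombine to
  a symmetric function of \<open>s\<close> and all eigenvalues but the \<open>i\<close>-th.\<close>

lemma Ep_diagm_add_outer:
  "Ep (Suc k) s (diagm d + outer v) = Ep (Suc k) s (diagm d)
     + (\<Sum>i\<in>UNIV. (v $ i)\<^sup>2 * esym (UNIV - {Some i}) k (case_option s d))"
proof -
  have U: "UNIV - {Some i} = insert None (Some ` (UNIV - {i}))" for i :: 'a
    by (auto simp: UNIV_option_conv)
  show ?thesis
  proof (cases k)
    case 0
    then show ?thesis by (simp add: Ep_def Tsum_diagm_add_outer Tsum_diagm)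
  next
    case (Suc q)
    show ?thesis
      unfolding Suc U esym_insert_None
      by (simp add: Ep_def Tsum_diagm_add_outer Tsum_diagm algebra_simps sum.distrib sum_distrib_left)
  qed
qed

lemma Ep_orthogonal:
  "orthogonal_matrix Q \<Longrightarrow> Ep k s (Q ** S ** transpose Q) = Ep k s S"
  by (simp add: Ep_def Tsum_orthogonal)

lemma outer_conj: "Q ** outer v ** transpose Q = outer (Q *v v)"
proof -
  define A where "A = Q ** outer v"
  have "A $ i $ j = (Q *v v) $ i * v $ j" for i j
    by (simp add: A_def matrix_matrix_mult_def matrix_vector_mult_def outer_def sum_distrib_left mult_ac)
  then have "(A ** transpose Q) $ i $ j = (\<Sum>k\<in>UNIV. (Q *v v) $ i * (Q $ j $ k * v $ k))" for i j
    by (simp add: matrix_matrix_mult_def transpose_def mult_ac)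
  then have "(Q ** outer v ** transpose Q) $ i $ j = (Q *v v) $ i * (Q *v v) $ j" for i j
    by (simp add: matrix_vector_mult_def[of Q v] A_def flip: sum_distrib_left)
  then show ?thesis by (simp add: outer_def vec_eq_iff)
qed

text \<open>Orthogonal invariance puts the cone condition into the form that
  \<open>esym_cone_remove\<close> expects, order 0 included.\<close>

lemma Kev_diagonal:
  assumes "Kev m s S" "orthogonal_matrix Q" "Q ** S ** transpose Q = diagm d" "k \<le> m"
  shows "0 < esym UNIV k (case_option s d)"
proof (cases k)
  case (Suc k')
  have "0 < Ep k s S" using assms Suc by (simp add: Kev_def)
  then show ?thesis using assms Suc Ep_orthogonal[of Q k s S] by (simp add: Ep_diagm)
qed simp

text \<open>After diagonalization the increment is a sum of squares with positive coefficients, by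
  \<open>esym_cone_remove\<close>. All orders up to \<open>m\<close> are treated so that the
  enlarged matrix stays in the cone.\<close>

lemma Ep_le_add_outer:
  assumes S: "transpose S = S" and K: "Kev m s S" and p: "p \<in> {1..m}"
  shows "Ep p s S \<le> Ep p s (S + outer v)"
proof -
  obtain Q d where Q: "orthogonal_matrix Q" "Q ** S ** transpose Q = diagm d"
    using symmetric_matrix_diagonalizable[OF S] .
  obtain k where k: "p = Suc k" using p by (cases p) auto
  obtain m' where m': "m = Suc m'" using p by (cases m) auto
  have "0 \<le> (\<Sum>i\<in>UNIV. ((Q *v v) $ i)\<^sup>2 * esym (UNIV - {Some i}) k (case_option s d))"
    using p k m'
    by (intro sum_nonneg mult_nonneg_nonneg less_imp_le[OF esym_cone_remove[where m = m']])
       (auto intro: Kev_diagonal[OF K Q])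
  then have "Ep p s (diagm d) \<le> Ep p s (diagm d + outer (Q *v v))"
    by (simp add: k Ep_diagm_add_outer)
  also have "diagm d + outer (Q *v v) = Q ** (S + outer v) ** transpose Q"
    by (simp add: matrix_add_ldistrib matrix_add_rdistrib Q outer_conj)
  finally show ?thesis using Ep_orthogonal[OF Q(1)] by (simp flip: Q(2))
qed

section \<open>Sums of rank-one matrices and positive semidefinite increments\<close>

lemma transpose_add: "transpose (A + B) = transpose A + transpose (B :: real^'n^'m)"
  by (simp add: transpose_def vec_eq_iff)

lemma transpose_outer: "transpose (outer v) = outer v"
  by (simp add: transpose_def outer_def vec_eq_iff mult.commute)

text \<open>The terms are added one at a time: monotonicity in every order keeps the partial sums in
  the cone, and their symmetry is carried along for the next diagonalization.\<close>

lemma Ep_le_add_sum_outer: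
  assumes "finite F" "transpose S = S" "Kev m s S"
  shows "transpose (S + (\<Sum>k\<in>F. outer (u k))) = S + (\<Sum>k\<in>F. outer (u k))
    \<and> (\<forall>p\<in>{1..m}. Ep p s S \<le> Ep p s (S + (\<Sum>k\<in>F. outer (u k))))"
  using assms
proof (induction F rule: finite_induct)
  case (insert k F)
  let ?S = "S + (\<Sum>k\<in>F. outer (u k))"
  have IH: "transpose ?S = ?S" "\<forall>p\<in>{1..m}. Ep p s S \<le> Ep p s ?S" using insert by auto
  then have "Kev m s ?S" using insert.prems unfolding Kev_def by fastforce
  then have "\<forall>p\<in>{1..m}. Ep p s ?S \<le> Ep p s (?S + outer (u k))"
    using IH Ep_le_add_outer by blast
  then have "\<forall>p\<in>{1..m}. Ep p s S \<le> Ep p s (?S + outer (u k))"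
    using IH(2) by (blast intro: order_trans)
  moreover have "transpose (?S + outer (u k)) = ?S + outer (u k)"
    by (simp only: transpose_add[of ?S] IH(1) transpose_outer)
  moreover have "?S + outer (u k) = S + (\<Sum>k\<in>insert k F. outer (u k))"
    using insert.hyps by (simp add: algebra_simps)
  ultimately show ?case by simp
qed simp

text \<open>The spectral theorem gives the vectors: the rows of \<open>Q\<close> scaled by the
  square roots of the eigenvalues.\<close>

lemma psd_sum_outer:
  fixes P :: "real^'n^'n"
  assumes "transpose P = P" "\<And>x. 0 \<le> x \<bullet> (P *v x)"
  shows "\<exists>u :: 'n \<Rightarrow> real^'n. P = (\<Sum>k\<in>UNIV. outer (u k))"
proof -
  obtain Q d where Q: "orthogonal_matrix Q" "Q ** P ** transpose Q = diagm d"
    using symmetric_matrix_diagonalizable[OF assms(1)] .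
  have d: "0 \<le> d k" for k
  proof -
    have "(Q ** (P ** transpose Q)) $ k $ k = row k Q \<bullet> (P *v row k Q)"
      by (simp add: matrix_matrix_mult_def matrix_vector_mult_def row_def transpose_def
          inner_vec_def)
    then show ?thesis using assms(2)[of "row k Q"] Q(2) by (simp add: diagm_def matrix_mul_assoc)
  qed
  have "P = (transpose Q ** Q) ** P ** (transpose Q ** Q)"
    using Q(1) by (simp add: orthogonal_matrix_def)
  also have "\<dots> = transpose Q ** (Q ** P ** transpose Q) ** Q"
    by (simp add: matrix_mul_assoc)
  also have "\<dots> = transpose Q ** diagm d ** Q" by (simp only: Q(2))
  finally have P: "P = transpose Q ** diagm d ** Q" .
  define R where "R = diagm d ** Q"
  have R: "R $ k $ j = d k * Q $ k $ j" for k j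
  proof -
    have "(if k = l then d k else 0) * Q $ l $ j = (if k = l then d k * Q $ k $ j else 0)" for l
      by simp
    then show ?thesis by (simp add: R_def matrix_matrix_mult_def diagm_def)
  qed
  have "P = transpose Q ** R" by (simp only: P R_def matrix_mul_assoc)
  then have "P $ i $ j = (\<Sum>k\<in>UNIV. Q $ k $ i * (d k * Q $ k $ j))" for i j
    by (simp add: matrix_matrix_mult_def transpose_def R)
  moreover have "outer (sqrt (d k) *\<^sub>R row k Q) $ i $ j = Q $ k $ i * (d k * Q $ k $ j)" for k i j
  proof -
    have "outer (sqrt (d k) *\<^sub>R row k Q) $ i $ j
        = Q $ k $ i * ((sqrt (d k) * sqrt (d k)) * Q $ k $ j)"
      by (simp only: outer_def row_def vec_lambda_beta vector_scaleR_component real_scaleR_def mult_ac)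
    also have "sqrt (d k) * sqrt (d k) = d k" using d[of k] by simp
    finally show ?thesis .
  qed
  ultimately have "P = (\<Sum>k\<in>UNIV. outer (sqrt (d k) *\<^sub>R row k Q))"
    by (simp add: vec_eq_iff)
  then show ?thesis by (intro exI[of _ "\<lambda>k. sqrt (d k) *\<^sub>R row k Q"])
qed

text \<open>Adding \<open>P\<close> does not lower \<open>Ep\<close>; strictness comes from
  \<open>s\<close>, in which \<open>Ep m\<close> is affine with slope
  \<open>Tsum (m - 1) (S + P)\<close>. This slope leaves out the variable \<open>s\<close>, hence is
  positive by \<open>esym_cone_remove\<close>.\<close>

theorem Ep_less_add:
  fixes S P :: "real^'n^'n"
  assumes "transpose S = S" "Kev m s S" "1 \<le> m" "0 < a"
    and "transpose P = P" "\<And>x. 0 \<le> x \<bullet> (P *v x)"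
  shows "Ep m s S < Ep m (s + a) (S + P)"
proof -
  obtain u :: "'n \<Rightarrow> real^'n" where "P = (\<Sum>k\<in>UNIV. outer (u k))"
    using psd_sum_outer[OF assms(5,6)] ..
  then have SP: "transpose (S + P) = S + P" and le: "\<forall>p\<in>{1..m}. Ep p s S \<le> Ep p s (S + P)"
    using Ep_le_add_sum_outer[of UNIV S m s u] assms by auto
  then have K: "Kev m s (S + P)" using assms(2) unfolding Kev_def by fastforce
  obtain Q d where Q: "orthogonal_matrix Q" "Q ** (S + P) ** transpose Q = diagm d"
    using symmetric_matrix_diagonalizable[OF SP] .
  obtain m' where m': "m = Suc m'" using assms(3) by (cases m) auto
  have "0 < esym (UNIV - {None}) m' (case_option s d)"
    by (rule esym_cone_remove[where m = m']) (auto simp: m' intro: Kev_diagonal[OF K Q])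
  also have "UNIV - {None} = range (Some :: 'n \<Rightarrow> _)" by (auto simp: UNIV_option_conv)
  also have "esym (range Some) m' (case_option s d) = Tsum m' (S + P)"
    using Tsum_orthogonal[OF Q(1), of m' "S + P"]
    by (simp add: esym_reindex o_def Q(2) Tsum_diagm)
  finally have "Ep m s (S + P) < Ep m (s + a) (S + P)"
    using assms(4) by (simp add: Ep_def m' algebra_simps)
  moreover have "Ep m s S \<le> Ep m s (S + P)" using le assms(3) by simp
  ultimately show ?thesis by simp
qed

subsection \<open>Second-order conditions\<close>

text \<open>Differentiability is demanded along the axes only, which is what \<open>C21\<close>
  provides; naming the derivatives \<open>D\<close> lets the notion be applied to them
  again.\<close>

definition has_partials ::
    "(real^'n) set \<Rightarrow> (real^'n \<Rightarrow> real) \<Rightarrow> ('n \<Rightarrow> real^'n \<Rightarrow> real) \<Rightarrow> bool" where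
  "has_partials U g D \<longleftrightarrow>
     (\<forall>x\<in>U. \<forall>i. ((\<lambda>h. g (x + h *\<^sub>R axis i 1)) has_real_derivative D i x) (at 0))"

lemma has_partials_line:
  assumes "has_partials U g D" "x + s *\<^sub>R axis i 1 \<in> U"
  shows "((\<lambda>s. g (x + s *\<^sub>R axis i 1)) has_real_derivative D i (x + s *\<^sub>R axis i 1)) (at s)"
proof -
  have "((\<lambda>h. g ((x + s *\<^sub>R axis i 1) + h *\<^sub>R axis i 1)) has_real_derivative
      D i (x + s *\<^sub>R axis i 1)) (at 0)"
    using assms by (auto simp: has_partials_def)
  then have "((\<lambda>h. g (x + (h + s) *\<^sub>R axis i 1)) has_real_derivative
      D i (x + s *\<^sub>R axis i 1)) (at 0)"
    by (simp add: algebra_simps)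
  then show ?thesis
    using DERIV_shift[of "\<lambda>s. g (x + s *\<^sub>R axis i 1)" _ 0 s] by simp
qed

lemma has_partials_diff:
  "has_partials U f D \<Longrightarrow> has_partials U g E \<Longrightarrow> has_partials U (\<lambda>x. f x - g x) (\<lambda>i x. D i x - E i x)"
  unfolding has_partials_def by (auto intro!: DERIV_diff)

text \<open>Telescoping over the coordinates, with the mean value theorem in each of them.\<close>
lemma partials_increment_bound:
  fixes g :: "real^'n \<Rightarrow> real"
  assumes g: "has_partials (ball x r) g D"
    and D: "\<And>i y. y \<in> ball x r \<Longrightarrow> \<bar>D i y - D i x\<bar> \<le> e"
    and F: "finite F" and h: "norm h < r" "\<And>i. i \<notin> F \<Longrightarrow> h $ i = 0"
  shows "\<bar>g (x + h) - g x - (\<Sum>i\<in>F. h $ i * D i x)\<bar> \<le> e * (\<Sum>i\<in>F. \<bar>h $ i\<bar>)"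
  using F h
proof (induction F arbitrary: h rule: finite_induct)
  case empty
  then have "h = 0" by (simp add: vec_eq_iff)
  then show ?case by simp
next
  case (insert i F)
  define k where "k = h - (h $ i) *\<^sub>R axis i 1"
  have kj: "k $ j = (if j = i then 0 else h $ j)" for j
    by (simp add: k_def axis_def)
  have "norm k \<le> norm h" by (rule norm_le_componentwise_cart) (simp add: kj)
  then have IH: "\<bar>g (x + k) - g x - (\<Sum>j\<in>F. k $ j * D j x)\<bar> \<le> e * (\<Sum>j\<in>F. \<bar>k $ j\<bar>)"
    using insert.prems by (intro insert.IH) (auto simp: kj)
  have sums: "(\<Sum>j\<in>F. k $ j * D j x) = (\<Sum>j\<in>F. h $ j * D j x)" "(\<Sum>j\<in>F. \<bar>k $ j\<bar>) = (\<Sum>j\<in>F. \<bar>h $ j\<bar>)"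
    using insert.hyps by (auto intro!: sum.cong simp: kj)
  have "\<bar>g (x + h) - g (x + k) - h $ i * D i x\<bar> \<le> e * \<bar>h $ i\<bar>"
  proof -
    \<comment> \<open>Subtracting the linear part \<open>s * D i x\<close> leaves a function along
      the axis whose derivative is at most \<open>e\<close> in modulus.\<close>
    let ?\<phi> = "\<lambda>s. g (x + k + s *\<^sub>R axis i 1) - s * D i x"
    let ?S = "closed_segment 0 (h $ i)"
    have inball: "x + k + s *\<^sub>R axis i 1 \<in> ball x r" if "s \<in> ?S" for s
    proof -
      have "\<bar>s\<bar> \<le> \<bar>h $ i\<bar>" using that by (auto simp: closed_segment_eq_real_ivl split: if_splits)
      then have "norm (k + s *\<^sub>R axis i 1) \<le> norm h"
        by (intro norm_le_componentwise_cart) (simp add: kj axis_def)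
      moreover have "dist x (x + k + s *\<^sub>R axis i 1) = norm (k + s *\<^sub>R axis i 1)"
        unfolding add.assoc dist_norm by (subst norm_minus_commute) simp
      ultimately show ?thesis using insert.prems by simp
    qed
    have "norm (?\<phi> (h $ i) - ?\<phi> 0) \<le> e * norm (h $ i - 0)"
    proof (rule field_differentiable_bound[of ?S])
      show "(?\<phi> has_field_derivative (D i (x + k + s *\<^sub>R axis i 1) - D i x)) (at s within ?S)"
        if "s \<in> ?S" for s
      proof -
        have "((\<lambda>s. s * D i x) has_real_derivative D i x) (at s)"
          using DERIV_cmult_right[OF DERIV_ident, of "D i x"] by simp
        from DERIV_diff[OF has_partials_line[OF g inball[OF that]] this]
        show ?thesis by (rule has_field_derivative_at_within)
      qed
      show "norm (D i (x + k + s *\<^sub>R axis i 1) - D i x) \<le> e" if "s \<in> ?S" for s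
        using D[OF inball[OF that]] by simp
    qed auto
    moreover have "x + k + h $ i *\<^sub>R axis i 1 = x + h" by (simp add: k_def)
    ultimately show ?thesis by (simp add: diff_right_commute)
  qed
  then show ?case
    using IH unfolding sums sum.insert[OF insert.hyps] distrib_left by linarith
qed

text \<open>Supplies the full derivative that the chain rule along an arbitrary direction
  needs.\<close>

lemma has_partials_has_derivative:
  fixes g :: "real^'n \<Rightarrow> real"
  assumes U: "open U" "x \<in> U" and g: "has_partials U g D"
    and D: "\<And>i. continuous_on U (D i)"
  shows "(g has_derivative (\<lambda>h. \<Sum>i\<in>UNIV. h $ i * D i x)) (at x)"
  unfolding has_derivative_at_alt
proof (intro conjI allI impI)
  show "bounded_linear (\<lambda>h. \<Sum>i\<in>UNIV. h $ i * D i x)"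
    by (intro bounded_linear_sum bounded_linear_mult_const bounded_linear_vec_nth)
  fix e :: real assume e: "0 < e"
  \<comment> \<open>The sum of the coordinate moduli is at most \<open>c\<close> times the norm,
    hence the tolerance \<open>e / c\<close> below.\<close>
  define c where "c = real CARD('n)"
  have c: "0 < c" by (simp add: c_def)
  have "\<forall>\<^sub>F y in nhds x. \<bar>D i y - D i x\<bar> < e / c" for i
  proof -
    have "isCont (D i) x" using D U continuous_on_eq_continuous_at by blast
    then show ?thesis
      using tendstoD[of "D i" "D i x" "nhds x" "e / c"] e c
      by (simp add: dist_real_def isCont_def tendsto_at_iff_tendsto_nhds)
  qed
  then have "\<forall>\<^sub>F y in nhds x. y \<in> U \<and> (\<forall>i. \<bar>D i y - D i x\<bar> < e / c)"
    using eventually_nhds_in_open[OF U] by (intro eventually_conj eventually_all_finite)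
  then obtain r where r: "0 < r" "\<And>y. dist y x < r \<Longrightarrow> y \<in> U \<and> (\<forall>i. \<bar>D i y - D i x\<bar> < e / c)"
    by (auto simp: eventually_nhds_metric)
  show "\<exists>d>0. \<forall>y. norm (y - x) < d \<longrightarrow>
      norm (g y - g x - (\<Sum>i\<in>UNIV. (y - x) $ i * D i x)) \<le> e * norm (y - x)"
  proof (intro exI[of _ r] conjI allI impI)
    fix y assume y: "norm (y - x) < r"
    have "\<bar>g (x + (y - x)) - g x - (\<Sum>i\<in>UNIV. (y - x) $ i * D i x)\<bar>
        \<le> e / c * (\<Sum>i\<in>UNIV. \<bar>(y - x) $ i\<bar>)"
    proof (rule partials_increment_bound[where r = r])
      show "has_partials (ball x r) g D"
        using g r(2) by (auto simp: has_partials_def dist_commute)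
      show "\<bar>D i z - D i x\<bar> \<le> e / c" if "z \<in> ball x r" for i z
        using r(2)[of z] that by (auto simp: dist_commute intro: less_imp_le)
    qed (use y in auto)
    also have "\<dots> \<le> e / c * (c * norm (y - x))"
      using e c unfolding c_def
      by (intro mult_left_mono sum_bounded_above component_le_norm_cart) auto
    finally show "norm (g y - g x - (\<Sum>i\<in>UNIV. (y - x) $ i * D i x)) \<le> e * norm (y - x)"
      using c by simp
  qed (rule r)
qed

text \<open>The mean value theorem is applied to the second difference first along axis
  \<open>i\<close>, then along axis \<open>j\<close>.\<close>

lemma mixed_difference_MVT:
  fixes g :: "real^'n \<Rightarrow> real"
  assumes g: "has_partials U g D" and D: "has_partials U (D i) (\<lambda>j. H j i)" and "0 < h"
    and U: "\<And>s t. \<lbrakk>0 \<le> s; s \<le> h; 0 \<le> t; t \<le> h\<rbrakk> \<Longrightarrow> x + s *\<^sub>R axis i 1 + t *\<^sub>R axis j 1 \<in> U"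
  obtains s t where "0 < s" "s < h" "0 < t" "t < h"
    "g (x + h *\<^sub>R axis i 1 + h *\<^sub>R axis j 1) - g (x + h *\<^sub>R axis i 1)
       - g (x + h *\<^sub>R axis j 1) + g x = h * h * H j i (x + s *\<^sub>R axis i 1 + t *\<^sub>R axis j 1)"
proof -
  let ?p = "\<lambda>s t. x + s *\<^sub>R axis i 1 + t *\<^sub>R axis j 1"
  have comm: "?p s t = x + t *\<^sub>R axis j 1 + s *\<^sub>R axis i 1" for s t by simp
  have der: "((\<lambda>s. g (?p s t)) has_real_derivative D i (?p s t)) (at s)"
    if "0 \<le> s" "s \<le> h" "0 \<le> t" "t \<le> h" for s t
    using has_partials_line[OF g, of "x + t *\<^sub>R axis j 1" s i] U[OF that] unfolding comm by simp
  have "\<exists>s>0. s < h \<and> (g (?p h h) - g (?p h 0)) - (g (?p 0 h) - g (?p 0 0))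
      = (h - 0) * (D i (?p s h) - D i (?p s 0))"
    using \<open>0 < h\<close> by (intro MVT2 DERIV_diff der) auto
  then obtain s where s: "0 < s" "s < h"
    "(g (?p h h) - g (?p h 0)) - (g (?p 0 h) - g (?p 0 0)) = h * (D i (?p s h) - D i (?p s 0))"
    by auto
  have "\<exists>t>0. t < h \<and> D i (?p s h) - D i (?p s 0) = (h - 0) * H j i (?p s t)"
    using \<open>0 < h\<close> s(1,2) by (intro MVT2 has_partials_line[OF D] U) auto
  then obtain t where t: "0 < t" "t < h" "D i (?p s h) - D i (?p s 0) = h * H j i (?p s t)"
    by auto
  show ?thesis
    by (rule that[OF s(1,2) t(1,2)]) (use s(3) t(3) in simp)
qed

text \<open>Schwarz's theorem: the second difference is symmetric in \<open>i\<close> and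
  \<open>j\<close>, so \<open>H j i\<close> and \<open>H i j\<close> take a common value arbitrarily
  close to \<open>x\<close>, and continuity concludes.\<close>

lemma mixed_partials_commute:
  fixes g :: "real^'n \<Rightarrow> real"
  assumes U: "open U" "x \<in> U" and g: "has_partials U g D"
    and D: "\<And>j. has_partials U (D j) (\<lambda>i. H i j)" and H: "\<And>i j. continuous_on U (H i j)"
  shows "H i j x = H j i x"
proof (rule ccontr)
  assume "H i j x \<noteq> H j i x"
  define e where "e = \<bar>H i j x - H j i x\<bar> / 2"
  have e: "0 < e" using \<open>H i j x \<noteq> H j i x\<close> by (simp add: e_def)
  have ev: "\<forall>\<^sub>F y in nhds x. \<bar>H k l y - H k l x\<bar> < e" for k l
  proof -
    have "isCont (H k l) x" using H U continuous_on_eq_continuous_at by blast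
    then show ?thesis
      using tendstoD[of "H k l" "H k l x" "nhds x" e] e
      by (simp add: dist_real_def isCont_def tendsto_at_iff_tendsto_nhds)
  qed
  have "\<forall>\<^sub>F y in nhds x. y \<in> U \<and> \<bar>H i j y - H i j x\<bar> < e \<and> \<bar>H j i y - H j i x\<bar> < e"
    by (intro eventually_conj eventually_nhds_in_open U ev)
  then obtain r where r: "0 < r"
    "\<And>y. dist y x < r \<Longrightarrow> y \<in> U \<and> \<bar>H i j y - H i j x\<bar> < e \<and> \<bar>H j i y - H j i x\<bar> < e"
    by (auto simp: eventually_nhds_metric)
  \<comment> \<open>Points of the square of side \<open>h\<close> then have distance at most
    \<open>2 * r / 3\<close> from \<open>x\<close>.\<close>
  define h where "h = r / 3"
  have h: "0 < h" using r by (simp add: h_def)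
  have near: "dist (x + s *\<^sub>R axis k 1 + t *\<^sub>R axis l 1) x < r"
    if "0 \<le> s" "s \<le> h" "0 \<le> t" "t \<le> h" for s t k l
  proof -
    have "norm (s *\<^sub>R axis k 1 + t *\<^sub>R axis l (1::real)) \<le> s + t"
      using norm_triangle_ineq[of "s *\<^sub>R axis k 1" "t *\<^sub>R axis l (1::real)"] that by simp
    also have "\<dots> < r" using that r by (simp add: h_def)
    finally show ?thesis by (simp add: dist_norm add.assoc)
  qed
  obtain s t where st: "0 < s" "s < h" "0 < t" "t < h"
    "g (x + h *\<^sub>R axis i 1 + h *\<^sub>R axis j 1) - g (x + h *\<^sub>R axis i 1)
       - g (x + h *\<^sub>R axis j 1) + g x = h * h * H j i (x + s *\<^sub>R axis i 1 + t *\<^sub>R axis j 1)"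
    using mixed_difference_MVT[where D = D and H = H and i = i and j = j and x = x, OF g D h] r(2)[OF near] by blast
  obtain s' t' where st': "0 < s'" "s' < h" "0 < t'" "t' < h"
    "g (x + h *\<^sub>R axis j 1 + h *\<^sub>R axis i 1) - g (x + h *\<^sub>R axis j 1)
       - g (x + h *\<^sub>R axis i 1) + g x = h * h * H i j (x + s' *\<^sub>R axis j 1 + t' *\<^sub>R axis i 1)"
    using mixed_difference_MVT[where D = D and H = H and i = j and j = i and x = x, OF g D h] r(2)[OF near] by blast
  have comm: "x + h *\<^sub>R axis j 1 + h *\<^sub>R axis i 1 = x + h *\<^sub>R axis i 1 + h *\<^sub>R axis j (1::real)" by simp
  then have "h * h * H j i (x + s *\<^sub>R axis i 1 + t *\<^sub>R axis j 1)
      = h * h * H i j (x + s' *\<^sub>R axis j 1 + t' *\<^sub>R axis i 1)"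
    using st(5) st'(5) unfolding comm by linarith
  then have "H j i (x + s *\<^sub>R axis i 1 + t *\<^sub>R axis j 1) = H i j (x + s' *\<^sub>R axis j 1 + t' *\<^sub>R axis i 1)"
    using h by simp
  moreover have "\<bar>H j i (x + s *\<^sub>R axis i 1 + t *\<^sub>R axis j 1) - H j i x\<bar> < e"
    using r(2)[OF near[of s t i j]] st by simp
  moreover have "\<bar>H i j (x + s' *\<^sub>R axis j 1 + t' *\<^sub>R axis i 1) - H i j x\<bar> < e"
    using r(2)[OF near[of s' t' j i]] st' by simp
  ultimately show False unfolding e_def by (simp add: abs_if split: if_splits)
qed

text \<open>A positive second derivative would make \<psi> positive just to the right of 0, so that
  \<phi> would exceed its maximum there.\<close>

lemma local_max_second_derivative:
  fixes \<phi> :: "real \<Rightarrow> real"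
  assumes "0 < r" and \<phi>: "\<And>s. \<bar>s\<bar> < r \<Longrightarrow> (\<phi> has_real_derivative \<psi> s) (at s)"
    and \<psi>: "(\<psi> has_real_derivative l) (at 0)" and max: "\<And>s. \<bar>s\<bar> < r \<Longrightarrow> \<phi> s \<le> \<phi> 0"
  shows "l \<le> 0"
proof (rule ccontr)
  assume "\<not> l \<le> 0"
  have "\<psi> 0 = 0"
    by (rule DERIV_local_max[OF \<phi>, of 0 r]) (use assms in auto)
  then obtain d where d: "0 < d" "\<And>h. 0 < h \<Longrightarrow> h < d \<Longrightarrow> 0 < \<psi> h"
    using DERIV_pos_inc_right[OF \<psi>] \<open>\<not> l \<le> 0\<close> by auto
  define b where "b = min d r / 2"
  have b: "0 < b" "b < d" "b < r" using d \<open>0 < r\<close> by (auto simp: b_def)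
  obtain z where "0 < z" "z < b" "\<phi> b - \<phi> 0 = (b - 0) * \<psi> z"
    using MVT2[of 0 b \<phi> \<psi>] \<phi> b by force
  moreover have "0 < b * \<psi> z" using d(2)[of z] b calculation by simp
  ultimately show False using max[of b] b by simp
qed

text \<open>The second-derivative test on the line through \<open>x\<close> in direction \<xi>, with
  the chain rule used for \<open>g\<close> and then for each \<open>D j\<close>.\<close>

lemma local_max_hessian:
  fixes g :: "real^'n \<Rightarrow> real"
  assumes U: "open U" "x \<in> U" and g: "has_partials U g D"
    and D: "\<And>j. has_partials U (D j) (\<lambda>i. H i j)"
    and cD: "\<And>i. continuous_on U (D i)" and cH: "\<And>i j. continuous_on U (H i j)"
    and max: "\<And>y. y \<in> U \<Longrightarrow> g y \<le> g x"
  shows "(\<Sum>i\<in>UNIV. \<Sum>j\<in>UNIV. \<xi> $ i * \<xi> $ j * H i j x) \<le> 0"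
proof -
  let ?p = "\<lambda>s. x + s *\<^sub>R \<xi>"
  have p: "(?p has_derivative (\<lambda>h. h *\<^sub>R \<xi>)) (at s)" for s
    by (auto intro!: derivative_eq_intros)
  have chain: "((\<lambda>s. f (?p s)) has_real_derivative (\<Sum>i\<in>UNIV. \<xi> $ i * E i (?p s))) (at s)"
    if "has_partials U f E" "\<And>i. continuous_on U (E i)" "?p s \<in> U" for f E s
  proof -
    have "((\<lambda>s. f (?p s)) has_derivative (\<lambda>h. \<Sum>i\<in>UNIV. (h *\<^sub>R \<xi>) $ i * E i (?p s))) (at s)"
      using has_derivative_compose[OF p has_partials_has_derivative[OF U(1) that(3,1,2)]] by simp
    moreover have "(\<lambda>h. \<Sum>i\<in>UNIV. (h *\<^sub>R \<xi>) $ i * E i (?p s)) = (*) (\<Sum>i\<in>UNIV. \<xi> $ i * E i (?p s))"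
      by (simp add: fun_eq_iff sum_distrib_left mult_ac)
    ultimately show ?thesis by (simp only: has_field_derivative_def)
  qed
  have "\<forall>\<^sub>F s in nhds 0. ?p s \<in> U"
  proof -
    have "isCont ?p 0" by (intro continuous_intros)
    then have "(?p \<longlongrightarrow> ?p 0) (nhds 0)"
      by (simp only: isCont_def tendsto_at_iff_tendsto_nhds[of ?p 0])
    then show ?thesis using U by (intro topological_tendstoD) auto
  qed
  then obtain r where r: "0 < r" "\<And>s. \<bar>s\<bar> < r \<Longrightarrow> ?p s \<in> U"
    by (auto simp: eventually_nhds_metric dist_real_def)
  have "(\<Sum>j\<in>UNIV. \<xi> $ j * (\<Sum>i\<in>UNIV. \<xi> $ i * H i j (?p 0))) \<le> 0"
  proof (rule local_max_second_derivative[OF r(1), of "\<lambda>s. g (?p s)"])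
    show "((\<lambda>s. g (?p s)) has_real_derivative (\<Sum>j\<in>UNIV. \<xi> $ j * D j (?p s))) (at s)"
      if "\<bar>s\<bar> < r" for s
      by (rule chain[OF g cD r(2)[OF that]])
    show "((\<lambda>s. \<Sum>j\<in>UNIV. \<xi> $ j * D j (?p s)) has_real_derivative
        (\<Sum>j\<in>UNIV. \<xi> $ j * (\<Sum>i\<in>UNIV. \<xi> $ i * H i j (?p 0)))) (at 0)"
      by (intro DERIV_sum DERIV_cmult chain[OF D cH] r(2)) (use r in simp)
    show "g (?p s) \<le> g (?p 0)" if "\<bar>s\<bar> < r" for s
      using max[OF r(2)[OF that]] by simp
  qed
  then show ?thesis
    by (subst sum.swap) (simp add: sum_distrib_left mult_ac)
qed

text \<open>The differentiability clauses of \<open>C21\<close> make \<open>deriv\<close> a genuine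
  derivative. In \<open>hess u z $ i $ j\<close> the outer derivative is the one along
  \<open>i\<close>.\<close>

lemma C21_slice:
  assumes "C21 (\<Omega> \<times> I) u" "t \<in> I"
  shows "has_partials \<Omega> (\<lambda>x. u (x, t)) (\<lambda>i x. pdx i u (x, t))"
    and "has_partials \<Omega> (\<lambda>x. pdx j u (x, t)) (\<lambda>i x. hess u (x, t) $ i $ j)"
    and "continuous_on \<Omega> (\<lambda>x. pdx i u (x, t))"
    and "continuous_on \<Omega> (\<lambda>x. hess u (x, t) $ i $ j)"
proof -
  have slice: "continuous_on \<Omega> (\<lambda>x. f (x, t))" if "continuous_on (\<Omega> \<times> I) f" for f :: "_ \<Rightarrow> real"
    using assms(2) by (intro continuous_on_compose2[OF that] continuous_intros) auto
  have dx: "((\<lambda>h. f (x + h *\<^sub>R axis i 1, t)) has_real_derivative pdx i f (x, t)) (at 0)"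
    if "diff_x i f (x, t)" for f i x
    using that DERIV_deriv_iff_real_differentiable[of "\<lambda>h. f (x + h *\<^sub>R axis i 1, t)" 0]
    by (simp add: diff_x_def pdx_def)
  show "has_partials \<Omega> (\<lambda>x. u (x, t)) (\<lambda>i x. pdx i u (x, t))"
    and "has_partials \<Omega> (\<lambda>x. pdx j u (x, t)) (\<lambda>i x. hess u (x, t) $ i $ j)"
    using assms by (auto simp: C21_def has_partials_def hess_def intro!: dx)
  show "continuous_on \<Omega> (\<lambda>x. pdx i u (x, t))"
    "continuous_on \<Omega> (\<lambda>x. hess u (x, t) $ i $ j)"
    using assms(1) by (auto simp: C21_def hess_def intro!: slice)
qed

text \<open>Schwarz's theorem on a time slice; the symmetry is what permits diagonalization.\<close>

lemma transpose_hess: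
  assumes "open \<Omega>" "C21 (\<Omega> \<times> I) u" "z \<in> \<Omega> \<times> I"
  shows "transpose (hess u z) = hess u z"
proof -
  obtain x t where z: "z = (x, t)" "x \<in> \<Omega>" "t \<in> I" using assms(3) by auto
  note slice = C21_slice[OF assms(2) z(3)]
  have "hess u (x, t) $ i $ j = hess u (x, t) $ j $ i" for i j
    by (rule mixed_partials_commute[where H = "\<lambda>i j x. hess u (x, t) $ i $ j", OF assms(1) z(2) slice(1,2,4)])
  then show ?thesis by (simp add: transpose_def vec_eq_iff z)
qed

lemma transpose_diff: "transpose (A - B) = transpose A - transpose (B :: real^'n^'m)"
  by (simp add: transpose_def vec_eq_iff)

subsection \<open>The comparison principle\<close>

theorem theorem3p6:
  fixes \<Omega> :: "(real^'n) set" and m :: nat and T :: real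
    and v w :: "(real^'n) \<times> real \<Rightarrow> real"
  assumes "open \<Omega>" "connected \<Omega>" "bounded \<Omega>" "\<Omega> \<noteq> {}"
    and "1 \<le> m" "m \<le> CARD('n)" "T > 0"
    and "continuous_on (closure \<Omega> \<times> {0..T}) v"
    and "continuous_on (closure \<Omega> \<times> {0..T}) w"
    and "C21 (\<Omega> \<times> {0<..<T}) v"
    and "w \<in> Kev_set m (\<Omega> \<times> {0<..<T})"
    and "\<forall>z\<in>\<Omega> \<times> {0<..<T}. Eop m v z - Eop m w z \<le> 0"
    and "\<forall>z\<in>(\<Omega> \<times> {0}) \<union> (frontier \<Omega> \<times> {0..T}). w z - v z \<le> 0"
  shows "\<forall>z\<in>closure \<Omega> \<times> {0..T}. w z \<le> v z"
proof (rule ccontr)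
  define f where "f z = w z - v z" for z
  have f: "continuous_on (closure \<Omega> \<times> {0..T}) f"
    unfolding f_def using assms(8,9) by (intro continuous_intros)
  have cl: "closure \<Omega> = \<Omega> \<union> frontier \<Omega>"
    using closure_Un_frontier by blast
  have bdry: "f (x, t) \<le> 0" if "x \<in> closure \<Omega>" "t \<in> {0..T}" "t = 0 \<or> x \<notin> \<Omega>" for x t
    using that assms(13) cl by (fastforce simp: f_def)
  assume "\<not> (\<forall>z\<in>closure \<Omega> \<times> {0..T}. w z \<le> v z)"
  then obtain x1 t' where x1: "x1 \<in> closure \<Omega>" "t' \<in> {0..T}" "0 < f (x1, t')"
    by (auto simp: f_def not_le)
  \<comment> \<open>The positive value may sit at an end of the time interval; continuity in time
    yields one at an interior time.\<close>
  have "\<exists>t1\<in>{0<..<T}. 0 < f (x1, t1)"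
  proof (rule ccontr)
    assume "\<not> (\<exists>t1\<in>{0<..<T}. 0 < f (x1, t1))"
    then have "\<forall>t\<in>{0<..<T}. f (x1, t) \<le> 0" by (auto simp: not_less)
    moreover have "continuous_on (closure {0<..<T}) (\<lambda>t. f (x1, t))"
      using assms(7) x1 by (auto intro!: continuous_on_compose2[OF f] continuous_intros)
    ultimately have "f (x1, t') \<le> 0"
      using continuous_le_on_closure[of "{0<..<T}" "\<lambda>t. f (x1, t)" t' 0] x1(2) assms(7) by auto
    then show False using x1 by simp
  qed
  then obtain t1 where t1: "0 < t1" "t1 < T" "0 < f (x1, t1)" by auto
  \<comment> \<open>The penalty \<epsilon> t takes away half of the value at
    \<open>(x1, t1)\<close>, leaving it positive there.\<close>
  define \<epsilon> where "\<epsilon> = f (x1, t1) / (2 * t1)"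
  have \<epsilon>: "0 < \<epsilon>" using t1 by (simp add: \<epsilon>_def)
  \<comment> \<open>The cylinder ends at \<open>t1 < T\<close>, so a maximum on its top face still
    lies where \<open>v\<close> and \<open>w\<close> have their derivatives.\<close>
  let ?K = "closure \<Omega> \<times> {0..t1}"
  have "compact ?K" using assms(3) by (intro compact_Times) auto
  moreover have "(x1, t1) \<in> ?K" using x1 t1 by simp
  moreover have "continuous_on ?K (\<lambda>z. f z - \<epsilon> * snd z)"
    using t1 by (intro continuous_intros continuous_on_subset[OF f]) auto
  ultimately obtain z0 where z0: "z0 \<in> ?K" "\<And>z. z \<in> ?K \<Longrightarrow> f z - \<epsilon> * snd z \<le> f z0 - \<epsilon> * snd z0"
    using continuous_attains_sup[of ?K "\<lambda>z. f z - \<epsilon> * snd z"] by blast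
  obtain x0 t0 where z0_eq: "z0 = (x0, t0)" by (cases z0)
  have x0: "x0 \<in> closure \<Omega>" "0 \<le> t0" "t0 \<le> t1" using z0(1) by (auto simp: z0_eq)
  have "0 < f (x1, t1) - \<epsilon> * t1" using t1 by (simp add: \<epsilon>_def field_simps)
  also have "\<dots> \<le> f (x0, t0) - \<epsilon> * t0" using z0(2)[OF \<open>(x1, t1) \<in> ?K\<close>] by (simp add: z0_eq)
  finally have "0 < f (x0, t0)" using \<epsilon> x0(2) by (smt (verit) mult_nonneg_nonneg)
  then have "x0 \<in> \<Omega>" "t0 \<noteq> 0" using bdry[of x0 t0] x0 t1 by auto
  then have in0: "x0 \<in> \<Omega>" "0 < t0" "t0 \<in> {0<..<T}" using x0 t1 by auto
  have w: "C21 (\<Omega> \<times> {0<..<T}) w" and wK: "Kev m (- pdt w (x0, t0)) (hess w (x0, t0))"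
    using assms(11) in0 by (auto simp: Kev_set_def)

  have dt: "((\<lambda>s. u (x0, s)) has_real_derivative pdt u (x0, t0)) (at t0)"
    if "C21 (\<Omega> \<times> {0<..<T}) u" for u
    using that in0 DERIV_deriv_iff_real_differentiable[of "\<lambda>s. u (x0, s)" t0]
    by (simp add: C21_def diff_t_def pdt_def)
  have "((\<lambda>s. f (x0, s) - \<epsilon> * s) has_real_derivative (pdt w (x0, t0) - pdt v (x0, t0) - \<epsilon> * 1)) (at t0)"
    unfolding f_def by (intro DERIV_diff DERIV_cmult DERIV_ident dt w assms(10))
  \<comment> \<open>Only earlier times are compared, as \<open>t0\<close> may equal
    \<open>t1\<close>.\<close>
  moreover have "f (x0, t0 - h) - \<epsilon> * (t0 - h) \<le> f (x0, t0) - \<epsilon> * t0" if "0 < h" "h < t0" for h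
    using z0(2)[of "(x0, t0 - h)"] that x0 by (simp add: z0_eq)
  ultimately have time: "\<epsilon> \<le> pdt w (x0, t0) - pdt v (x0, t0)"
  proof -
    assume D: "((\<lambda>s. f (x0, s) - \<epsilon> * s) has_real_derivative
        (pdt w (x0, t0) - pdt v (x0, t0) - \<epsilon> * 1)) (at t0)"
      and max: "\<And>h. 0 < h \<Longrightarrow> h < t0 \<Longrightarrow> f (x0, t0 - h) - \<epsilon> * (t0 - h) \<le> f (x0, t0) - \<epsilon> * t0"
    show ?thesis
    proof (rule ccontr)
      assume "\<not> ?thesis"
      then obtain d where d: "0 < d"
        "\<And>h. 0 < h \<Longrightarrow> h < d \<Longrightarrow> f (x0, t0) - \<epsilon> * t0 < f (x0, t0 - h) - \<epsilon> * (t0 - h)"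
        using DERIV_neg_dec_left[OF D] by auto
      define h where "h = min d t0 / 2"
      have "0 < h" "h < d" "h < t0" using d in0 by (auto simp: h_def)
      then show False using d(2)[of h] max[of h] by simp
    qed
  qed

  define P where "P = hess v (x0, t0) - hess w (x0, t0)"
  have z0_in: "(x0, t0) \<in> \<Omega> \<times> {0<..<T}" using in0 by simp
  have symw: "transpose (hess w (x0, t0)) = hess w (x0, t0)"
    by (rule transpose_hess[OF assms(1) w z0_in])
  have symP: "transpose P = P"
    unfolding P_def transpose_diff symw transpose_hess[OF assms(1,10) z0_in] ..
  note sw = C21_slice[OF w in0(3)] and sv = C21_slice[OF assms(10) in0(3)]
  \<comment> \<open>At the fixed time \<open>t0\<close> the penalty is constant, so
    \<open>x0\<close> maximizes \<open>w - v\<close> over \<Omega>.\<close>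
  have psd: "0 \<le> \<xi> \<bullet> (P *v \<xi>)" for \<xi>
  proof -
    have "(\<Sum>i\<in>UNIV. \<Sum>j\<in>UNIV. \<xi> $ i * \<xi> $ j
        * (hess w (x0, t0) $ i $ j - hess v (x0, t0) $ i $ j)) \<le> 0"
    proof (rule local_max_hessian[OF assms(1) in0(1)])
      show "has_partials \<Omega> (\<lambda>x. w (x, t0) - v (x, t0)) (\<lambda>i x. pdx i w (x, t0) - pdx i v (x, t0))"
        by (intro has_partials_diff sw sv)
      show "has_partials \<Omega> (\<lambda>x. pdx j w (x, t0) - pdx j v (x, t0))
          (\<lambda>i x. hess w (x, t0) $ i $ j - hess v (x, t0) $ i $ j)" for j
        by (intro has_partials_diff sw sv)
      show "w (y, t0) - v (y, t0) \<le> w (x0, t0) - v (x0, t0)" if "y \<in> \<Omega>" for y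
        using z0(2)[of "(y, t0)"] that x0 cl by (simp add: z0_eq f_def)
    qed (intro continuous_intros sw sv)+
    moreover have "\<xi> \<bullet> (P *v \<xi>) = - (\<Sum>i\<in>UNIV. \<Sum>j\<in>UNIV. \<xi> $ i * \<xi> $ j
        * (hess w (x0, t0) $ i $ j - hess v (x0, t0) $ i $ j))"
      by (simp add: P_def inner_vec_def matrix_vector_mult_def sum_distrib_left algebra_simps
          flip: sum_negf)
    ultimately show ?thesis by simp
  qed

  \<comment> \<open>The increment of \<open>s\<close> is \<open>pdt w - pdt v\<close>, at least
    \<epsilon>, and the enlarged arguments are exactly those of \<open>v\<close>.\<close>
  have "Ep m (- pdt w (x0, t0)) (hess w (x0, t0))
      < Ep m (- pdt w (x0, t0) + (pdt w (x0, t0) - pdt v (x0, t0))) (hess w (x0, t0) + P)"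
    by (rule Ep_less_add[OF symw wK assms(5) _ symP psd]) (use time \<epsilon> in simp)
  then have "Eop m w (x0, t0) < Eop m v (x0, t0)"
    by (simp add: Eop_def P_def)
  then show False using bspec[OF assms(12) z0_in] by simp
qed

end
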